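(* For every metric space $X$ the following equality holds: $$\ell\text{-}\mathrm{asdim}_*X=\min\{\ell\text{-}\mathrm{asdim}_{\omega}X : \omega\in\mathbb N^*\}.$$
   Context: $\mathbb N^*=\beta\mathbb N\setminus\mathbb N$ is the set of non-principal ultrafilters on $\mathbb N$. Let $(X,d)$ be a metric space. For subsets $U,V\subset X$ put $d(U,V)=\inf\{d(u,v)\mid u\in U, v\in V\}$. A family of subsets of $X$ is $\lambda$-disjoint if $d(U,V)>\lambda$ for any two distinct members $U,V$; it is $D$-uniformly bounded if $\mathrm{diam}(U)\le D$ for every member $U$. For an integer $n\ge 0$, write $(\lambda,D)\text{-}\dim X\le n$ if there are $n+1$ families $\mathcal U^0,\dots,\mathcal U^n$ of subsets of $X$, each $\lambda$-disjoint and $D$-uniformly bounded, such that $\mathcal U^0\cup\dots\cup\mathcal U^n$ covers $X$; $(\lambda,D)\text{-}\dim X$ is the smallest integer $n\ge 0$ with this property, and $\infty$ if there is none. $\ell\text{-}\mathrm{asdim}_*X\le n$ (asymptotic dimension with linear control) means: there is $c>0$ such that for every $R<\infty$ there is $\lambda>R$ with $(\lambda,c\lambda)\text{-}\dim X\le n$; $\ell\text{-}\mathrm{asdim}_*X$ is the smallest integer $n\ge 0$ for which this holds, and $\infty$ if there is none. For a real $c>0$ let $f_c:\mathbb N\to\alpha\mathbb N=\mathbb N\cup\{\infty\}$ (the one-point compactification of the discrete space $\mathbb N=\{0,1,2,\dots\}$ of values) be $f_c(\lambda)=(\lambda,c\lambda)\text{-}\dim X$, and for $\omega\in\mathbb N^*$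 let $\overline f_c(\omega)=\lim_\omega f_c\in\alpha\mathbb N$ be its limit along $\omega$. The asymptotic dimension with linear control with respect to $\omega$ is $\ell\text{-}\mathrm{asdim}_\omega X=\min_{c>0}\overline f_c(\omega)$. *)

theory Defs
  imports "HOL-Analysis.Analysis"
begin

text \<open>Metric spaces are given by a carrier and a distance function, as in the
  locale \<^locale>\<open>Metric_space\<close>; the carrier may be empty.\<close>

text \<open>Distances between sets and diameters are extended reals: the distance to the
  empty set is \<open>\<infinity>\<close>, and the diameter of an unbounded set is \<open>\<infinity>\<close>. The diameter of
  the empty set comes out as \<open>-\<infinity>\<close>; this is harmless since empty members can
  always be removed from a family.\<close>

definition set_distance :: "('a \<Rightarrow> 'a \<Rightarrow> real) \<Rightarrow> 'a set \<Rightarrow> 'a set \<Rightarrow> ereal" where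
  "set_distance d U V = (INF (u, v)\<in>U \<times> V. ereal (d u v))"

definition set_diam :: "('a \<Rightarrow> 'a \<Rightarrow> real) \<Rightarrow> 'a set \<Rightarrow> ereal" where
  "set_diam d U = (SUP (u, v)\<in>U \<times> U. ereal (d u v))"

definition separated_family :: "('a \<Rightarrow> 'a \<Rightarrow> real) \<Rightarrow> real \<Rightarrow> 'a set set \<Rightarrow> bool" where
  "separated_family d l \<U> \<longleftrightarrow>
     (\<forall>U\<in>\<U>. \<forall>V\<in>\<U>. U \<noteq> V \<longrightarrow> set_distance d U V > ereal l)"

definition uniformly_bounded_family ::
    "('a \<Rightarrow> 'a \<Rightarrow> real) \<Rightarrow> real \<Rightarrow> 'a set set \<Rightarrow> bool" where
  "uniformly_bounded_family d D \<U> \<longleftrightarrow> (\<forall>U\<in>\<U>. set_diam d U \<le> ereal D)"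

definition scale_dim_le ::
    "'a set \<Rightarrow> ('a \<Rightarrow> 'a \<Rightarrow> real) \<Rightarrow> real \<Rightarrow> real \<Rightarrow> nat \<Rightarrow> bool" where
  "scale_dim_le M d l D n \<longleftrightarrow>
     (\<exists>\<U> :: nat \<Rightarrow> 'a set set.
        (\<forall>i\<le>n. (\<forall>U\<in>\<U> i. U \<subseteq> M) \<and> separated_family d l (\<U> i) \<and>
               uniformly_bounded_family d D (\<U> i)) \<and>
        M \<subseteq> (\<Union>i\<le>n. \<Union>(\<U> i)))"

definition least_enat :: "(nat \<Rightarrow> bool) \<Rightarrow> enat" where
  "least_enat P = (if \<exists>n. P n then enat (LEAST n. P n) else \<infinity>)"

definition scale_dim :: "'a set \<Rightarrow> ('a \<Rightarrow> 'a \<Rightarrow> real) \<Rightarrow> real \<Rightarrow> real \<Rightarrow> enat" where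
  "scale_dim M d l D = least_enat (scale_dim_le M d l D)"

definition lasdim_star_le :: "'a set \<Rightarrow> ('a \<Rightarrow> 'a \<Rightarrow> real) \<Rightarrow> nat \<Rightarrow> bool" where
  "lasdim_star_le M d n \<longleftrightarrow>
     (\<exists>c>0. \<forall>R::real. \<exists>l>R. scale_dim_le M d l (c * l) n)"

definition lasdim_star :: "'a set \<Rightarrow> ('a \<Rightarrow> 'a \<Rightarrow> real) \<Rightarrow> enat" where
  "lasdim_star M d = least_enat (lasdim_star_le M d)"

text \<open>An ultrafilter on the natural numbers is a proper filter deciding every
  predicate; it is non-principal if it is not generated by a singleton.\<close>

definition nonprincipal_ultrafilters :: "nat filter set" where
  "nonprincipal_ultrafilters =
     {F. F \<noteq> bot \<and>
         (\<forall>P. eventually P F \<or> eventually (\<lambda>k. \<not> P k) F) \<and>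
         (\<forall>k. F \<noteq> principal {k})}"

text \<open>The order topology of \<^typ>\<open>enat\<close> is the one-point compactification of the
  discrete natural numbers (see \<open>open_enat_iff\<close>). As this space is compact and Hausdorff,
  the limit along an ultrafilter always exists and is unique.\<close>

definition ultra_dim ::
    "'a set \<Rightarrow> ('a \<Rightarrow> 'a \<Rightarrow> real) \<Rightarrow> real \<Rightarrow> nat filter \<Rightarrow> enat" where
  "ultra_dim M d c \<omega> = Lim \<omega> (\<lambda>k. scale_dim M d (real k) (c * real k))"

text \<open>The infimum is a minimum because \<^typ>\<open>enat\<close> is well-ordered.\<close>

definition lasdim_ultra ::
    "'a set \<Rightarrow> ('a \<Rightarrow> 'a \<Rightarrow> real) \<Rightarrow> nat filter \<Rightarrow> enat" where
  "lasdim_ultra M d \<omega> = (INF c\<in>{0<..}. ultra_dim M d c \<omega>)"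

end

theory Submission
  imports Defs
begin

text \<open>
  Fix \<open>n\<close>. Both sides of the equality are at most \<open>n\<close> under the same condition: for some
  \<open>c > 0\<close> the set of natural numbers
  \<open>{k. (k, c k)-dim X \<le> n}\<close> is infinite.

  For the left side this is a discretization of the scales: rounding a real scale \<open>\<lambda> \<ge> 1\<close> down to
  \<open>k = \<lfloor>\<lambda>\<rfloor>\<close> keeps disjointness, and since \<open>\<lambda> \<le> 2k\<close> it costs only a factor \<open>2\<close> in \<open>c\<close>
  (\<open>lasdim_star_le_iff_infinite\<close>).
  For the right side, the limit along \<open>\<omega>\<close> of a sequence in \<open>\<alpha>\<nat>\<close> is at most \<open>n\<close> exactly when the
  sequence is at most \<open>n\<close> on a set belonging to \<open>\<omega>\<close>, because the initial segment up to \<open>n\<close> is clopen in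
  \<open>\<alpha>\<nat>\<close> (\<open>Lim_ultrafilter_le_enat_iff\<close>). A set of natural numbers belongs to some non-principal
  ultrafilter if and only if it is infinite, by the ultrafilter lemma
  (\<open>infinite_iff_in_nonprincipal_ultrafilter\<close>).
  The infima on the right are attained because \<^typ>\<open>enat\<close> is well-ordered.
\<close>

section \<open>Ultrafilters\<close>

text \<open>Zorn's lemma gives a minimal proper filter below \<open>F\<close>. Minimality makes it decide every predicate
  \<open>P\<close>: adding \<open>P\<close> to the filter either leaves it unchanged or makes it improper.\<close>

lemma ultrafilter_lemma:
  fixes F :: "'b filter"
  assumes "F \<noteq> bot"
  obtains G where "G \<le> F" "G \<noteq> bot"
    "\<And>P. eventually P G \<or> eventually (\<lambda>x. \<not> P x) G"
proof -
  define A where "A = {G. G \<le> F \<and> G \<noteq> bot}"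
  have po: "partial_order_on A (relation_of (\<ge>) A)"
    by (rule partial_order_on_relation_ofI) auto
  have "\<exists>u\<in>A. \<forall>a\<in>C. u \<le> a" if C: "C \<in> Chains (relation_of (\<ge>) A)" for C
  proof (cases "C = {}")
    case True
    then show ?thesis using assms by (auto simp: A_def)
  next
    case False
    have CA: "C \<subseteq> A" and chain: "\<And>G H. G \<in> C \<Longrightarrow> H \<in> C \<Longrightarrow> G \<le> H \<or> H \<le> G"
      using C by (auto simp: Chains_def relation_of_def)
    have "\<exists>K\<in>C. K \<le> inf G H" if "G \<in> C" "H \<in> C" for G H
      using chain[OF that] that by auto
    then have "eventually (\<lambda>_. False) (Inf C) \<longleftrightarrow> (\<exists>G\<in>C. eventually (\<lambda>_. False) G)"
      by (rule eventually_Inf_base[OF False])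
    then have "\<not> eventually (\<lambda>_. False) (Inf C)"
      using CA by (auto simp: A_def trivial_limit_def)
    then have "Inf C \<noteq> bot"
      by (simp add: trivial_limit_def)
    moreover obtain G where "G \<in> C" using False by blast
    then have "Inf C \<le> F"
      using CA Inf_lower[of G C] by (auto simp: A_def)
    ultimately have "Inf C \<in> A" by (simp add: A_def)
    then show ?thesis by (auto intro!: bexI[of _ "Inf C"] Inf_lower)
  qed
  then have "\<exists>G\<in>A. \<forall>H\<in>A. H \<le> G \<longrightarrow> H = G"
    by (rule predicate_Zorn[OF po])
  then obtain G
    where G: "G \<in> A" and minimal: "\<And>H. H \<in> A \<Longrightarrow> H \<le> G \<Longrightarrow> H = G"
    by auto
  have "eventually P G \<or> eventually (\<lambda>x. \<not> P x) G" for P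
  proof (rule disjCI)
    assume "\<not> eventually (\<lambda>x. \<not> P x) G"
    then have "inf G (principal {x. P x}) \<noteq> bot"
      by (simp add: trivial_limit_def eventually_inf_principal)
    with G have "inf G (principal {x. P x}) \<in> A"
      by (auto simp: A_def intro: le_infI1)
    then have "inf G (principal {x. P x}) = G"
      by (intro minimal) auto
    moreover have "eventually P (inf G (principal {x. P x}))"
      by (simp add: eventually_inf_principal)
    ultimately show "eventually P G" by simp
  qed
  with G show ?thesis by (intro that[of G]) (auto simp: A_def)
qed

text \<open>A proper ultrafilter that does not avoid the point \<open>k\<close> contains \<open>{k}\<close> and is therefore
  principal; so a non-principal one avoids every initial segment.\<close>

lemma nonprincipal_ultrafilter_le_sequentially:
  assumes "\<omega> \<in> nonprincipal_ultrafilters"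
  shows "\<omega> \<le> sequentially"
proof -
  have proper: "\<omega> \<noteq> bot"
    and ultra: "\<And>P. eventually P \<omega> \<or> eventually (\<lambda>k. \<not> P k) \<omega>"
    and nonprincipal: "\<And>k. \<omega> \<noteq> principal {k}"
    using assms by (auto simp: nonprincipal_ultrafilters_def)
  have avoids: "eventually (\<lambda>j. j \<noteq> k) \<omega>" for k
  proof (rule ccontr)
    assume "\<not> eventually (\<lambda>j. j \<noteq> k) \<omega>"
    then have at_k: "eventually (\<lambda>j. j = k) \<omega>"
      using ultra[of "\<lambda>j. j = k"] by simp
    have "eventually P \<omega> \<longleftrightarrow> P k" for P
    proof
      assume "eventually P \<omega>"
      with at_k have "eventually (\<lambda>_. P k) \<omega>"
        by eventually_elim simp
      then show "P k" using proper by simp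
    next
      assume "P k"
      with at_k show "eventually P \<omega>" by (auto elim: eventually_mono)
    qed
    then have "\<omega> = principal {k}"
      by (simp add: filter_eq_iff eventually_principal)
    with nonprincipal show False by blast
  qed
  have "eventually (\<lambda>j. N \<le> j) \<omega>" for N
  proof -
    have "eventually (\<lambda>j. \<forall>k\<in>{..<N}. j \<noteq> k) \<omega>"
      by (intro eventually_ball_finite) (auto intro: avoids)
    then show ?thesis by (rule eventually_mono) (auto simp: not_le[symmetric])
  qed
  then show ?thesis
    by (auto simp: le_sequentially)
qed

lemma infinite_iff_in_nonprincipal_ultrafilter:
  fixes P :: "nat \<Rightarrow> bool"
  shows "infinite {k. P k} \<longleftrightarrow> (\<exists>\<omega>\<in>nonprincipal_ultrafilters. eventually P \<omega>)"
proof
  assume "infinite {k. P k}"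
  then have "\<exists>\<^sub>F k in sequentially. P k"
    by (simp add: frequently_cofinite cofinite_eq_sequentially[symmetric])
  then have "inf sequentially (principal {k. P k}) \<noteq> bot"
    by (simp add: trivial_limit_def eventually_inf_principal frequently_def)
  then obtain \<omega> where \<omega>: "\<omega> \<le> inf sequentially (principal {k. P k})" "\<omega> \<noteq> bot"
    "\<And>Q. eventually Q \<omega> \<or> eventually (\<lambda>k. \<not> Q k) \<omega>"
    using ultrafilter_lemma by blast
  have "\<omega> \<noteq> principal {k}" for k
  proof
    assume "\<omega> = principal {k}"
    moreover have "eventually (\<lambda>j. k < j) \<omega>"
      using \<omega>(1) eventually_gt_at_top[of k] by (auto intro: filter_leD)
    ultimately show False by (simp add: eventually_principal)
  qed
  with \<omega> have "\<omega> \<in> nonprincipal_ultrafilters"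
    by (simp add: nonprincipal_ultrafilters_def)
  moreover have "eventually P \<omega>"
    using \<omega>(1) by (rule filter_leD) (simp add: eventually_inf_principal)
  ultimately show "\<exists>\<omega>\<in>nonprincipal_ultrafilters. eventually P \<omega>" by blast
next
  assume "\<exists>\<omega>\<in>nonprincipal_ultrafilters. eventually P \<omega>"
  then obtain \<omega> where \<omega>: "\<omega> \<in> nonprincipal_ultrafilters" "eventually P \<omega>" by blast
  show "infinite {k. P k}"
  proof
    assume "finite {k. P k}"
    then have "eventually (\<lambda>k. \<not> P k) sequentially"
      by (simp add: eventually_cofinite cofinite_eq_sequentially[symmetric])
    then have "eventually (\<lambda>k. \<not> P k) \<omega>"
      using nonprincipal_ultrafilter_le_sequentially[OF \<omega>(1)] by (rule filter_leD[rotated])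
    with \<omega>(2) have "eventually (\<lambda>_. False) \<omega>"
      by eventually_elim simp
    with \<omega>(1) show False by (simp add: nonprincipal_ultrafilters_def)
  qed
qed

section \<open>Limits along ultrafilters\<close>

text \<open>The limit inferior is the limit: for \<open>a\<close> above it, \<open>f \<ge> a\<close> cannot hold eventually, so the
  ultrafilter must contain \<open>f < a\<close>.\<close>

lemma tendsto_Liminf_ultrafilter:
  fixes f :: "'b \<Rightarrow> 'c::{complete_linorder, linorder_topology}"
  assumes "\<And>P. eventually P F \<or> eventually (\<lambda>x. \<not> P x) F"
  shows "(f \<longlongrightarrow> Liminf F f) F"
proof (rule order_tendstoI)
  fix a assume "a < Liminf F f"
  then show "eventually (\<lambda>x. a < f x) F" by (rule less_LiminfD)
next
  fix a assume a: "Liminf F f < a"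
  have "\<not> eventually (\<lambda>x. \<not> f x < a) F"
  proof
    assume "eventually (\<lambda>x. \<not> f x < a) F"
    then have "a \<le> Liminf F f" by (intro Liminf_bounded) (simp add: not_less)
    with a show False by simp
  qed
  then show "eventually (\<lambda>x. f x < a) F"
    using assms[of "\<lambda>x. f x < a"] by blast
qed

lemma le_enat_iff_less_Suc: "x \<le> enat n \<longleftrightarrow> x < enat (Suc n)"
  by (cases x) auto

text \<open>The set \<open>{x. x \<le> enat n}\<close> is closed, and it is open because it equals
  \<open>{x. x < enat (Suc n)}\<close>; each property yields one direction.\<close>

lemma Lim_ultrafilter_le_enat_iff:
  fixes f :: "'b \<Rightarrow> enat"
  assumes "F \<noteq> bot" and "\<And>P. eventually P F \<or> eventually (\<lambda>x. \<not> P x) F"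
  shows "Lim F f \<le> enat n \<longleftrightarrow> eventually (\<lambda>x. f x \<le> enat n) F"
proof -
  have lim: "(f \<longlongrightarrow> Lim F f) F"
    using tendsto_Liminf_ultrafilter[of F f, OF assms(2)] tendsto_Lim[OF assms(1)] by metis
  show ?thesis
  proof
    assume "Lim F f \<le> enat n"
    then show "eventually (\<lambda>x. f x \<le> enat n) F"
      using order_tendstoD(2)[OF lim, of "enat (Suc n)"] by (simp add: le_enat_iff_less_Suc)
  next
    assume "eventually (\<lambda>x. f x \<le> enat n) F"
    then show "Lim F f \<le> enat n"
      using lim assms(1) by (intro tendsto_upperbound)
  qed
qed

section \<open>Extended natural numbers\<close>

lemma least_enat_le_iff:
  assumes "mono P"
  shows "least_enat P \<le> enat n \<longleftrightarrow> P n"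
proof
  assume "least_enat P \<le> enat n"
  then have "\<exists>m. P m" and "(LEAST m. P m) \<le> n"
    by (auto simp: least_enat_def split: if_splits)
  then show "P n" using monoD[OF assms] LeastI_ex[of P] by auto
qed (auto simp: least_enat_def intro: Least_le)

lemma INF_le_enat_iff:
  fixes g :: "'b \<Rightarrow> enat"
  shows "(INF x\<in>A. g x) \<le> enat n \<longleftrightarrow> (\<exists>x\<in>A. g x \<le> enat n)"
  by (simp add: le_enat_iff_less_Suc INF_less_iff)

lemma enat_eqI:
  fixes a b :: enat
  assumes "\<And>n. a \<le> enat n \<longleftrightarrow> b \<le> enat n"
  shows "a = b"
  using assms by (cases a; cases b) (auto intro: antisym)

section \<open>Dimension at a scale and linear control\<close>

lemma scale_dim_le_mono:
  assumes "scale_dim_le M d l D n" and "l' \<le> l" and "D \<le> D'" and "n \<le> n'"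
  shows "scale_dim_le M d l' D' n'"
proof -
  obtain \<U> where \<U>: "\<And>i. i \<le> n \<Longrightarrow> (\<forall>U\<in>\<U> i. U \<subseteq> M) \<and> separated_family d l (\<U> i) \<and>
               uniformly_bounded_family d D (\<U> i)"
    and cover: "M \<subseteq> (\<Union>i\<le>n. \<Union>(\<U> i))"
    using assms(1) by (auto simp: scale_dim_le_def)
  \<comment> \<open>Surplus families are taken to be empty.\<close>
  define \<V> where "\<V> i = (if i \<le> n then \<U> i else {})" for i
  have "separated_family d l' (\<V> i)" for i
    using \<U>[of i] \<open>l' \<le> l\<close>
    unfolding \<V>_def separated_family_def by (simp, meson ereal_less_eq(3) le_less_trans)
  moreover have "uniformly_bounded_family d D' (\<V> i)" for i
    using \<U>[of i] \<open>D \<le> D'\<close>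
    by (auto simp: \<V>_def uniformly_bounded_family_def intro: order_trans[of _ "ereal D" "ereal D'"])
  moreover have "M \<subseteq> (\<Union>i\<le>n'. \<Union>(\<V> i))"
  proof
    fix x assume "x \<in> M"
    then obtain i U where "i \<le> n" "U \<in> \<U> i" "x \<in> U" using cover by blast
    then show "x \<in> (\<Union>i\<le>n'. \<Union>(\<V> i))"
      using \<open>n \<le> n'\<close> by (auto simp: \<V>_def intro!: bexI[of _ i] bexI[of _ U])
  qed
  moreover have "\<forall>U\<in>\<V> i. U \<subseteq> M" for i using \<U>[of i] by (simp add: \<V>_def)
  ultimately show ?thesis unfolding scale_dim_le_def by blast
qed

lemma mono_scale_dim_le: "mono (scale_dim_le M d l D)"
proof (rule monoI)
  fix n n' :: nat
  assume "n \<le> n'"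
  then show "scale_dim_le M d l D n \<le> scale_dim_le M d l D n'"
    using scale_dim_le_mono[OF _ order_refl order_refl] by (intro le_boolI)
qed

lemma mono_lasdim_star_le: "mono (lasdim_star_le M d)"
proof (rule monoI)
  fix n n' :: nat
  assume "n \<le> n'"
  then have "scale_dim_le M d l D n \<Longrightarrow> scale_dim_le M d l D n'" for l D
    by (auto intro: scale_dim_le_mono[OF _ order_refl order_refl])
  then show "lasdim_star_le M d n \<le> lasdim_star_le M d n'"
    unfolding lasdim_star_le_def by (intro le_boolI) blast
qed

lemma lasdim_star_le_iff_infinite:
  "lasdim_star_le M d n \<longleftrightarrow> (\<exists>c>0. infinite {k. scale_dim_le M d (real k) (c * real k) n})"
proof
  assume "lasdim_star_le M d n"
  then obtain c where c: "c > 0" "\<And>R::real. \<exists>l>R. scale_dim_le M d l (c * l) n"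
    by (auto simp: lasdim_star_le_def)
  have "\<exists>k>N. scale_dim_le M d (real k) ((2 * c) * real k) n" for N
  proof -
    obtain l where l: "l > real N + 1" "scale_dim_le M d l (c * l) n" using c(2) by blast
    define k where "k = nat \<lfloor>l\<rfloor>"
    have k: "real k \<le> l" "l < real k + 1"
      using l(1) by (auto simp: k_def)
    with l(1) have "k > N" by simp
    then have "l \<le> 2 * real k" using k(2) by simp
    then have "c * l \<le> (2 * c) * real k" using \<open>c > 0\<close> by simp
    with l(2) k(1) \<open>k > N\<close> show ?thesis by (blast intro: scale_dim_le_mono)
  qed
  then have "infinite {k. scale_dim_le M d (real k) ((2 * c) * real k) n}"
    by (simp add: infinite_nat_iff_unbounded)
  then show "\<exists>c>0. infinite {k. scale_dim_le M d (real k) (c * real k) n}"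
    using \<open>c > 0\<close> by (intro exI[of _ "2 * c"]) simp
next
  assume "\<exists>c>0. infinite {k. scale_dim_le M d (real k) (c * real k) n}"
  then obtain c where c: "c > 0" "infinite {k. scale_dim_le M d (real k) (c * real k) n}" by blast
  have "\<exists>l>R. scale_dim_le M d l (c * l) n" for R :: real
  proof -
    obtain N where "R < real N" using reals_Archimedean2 by blast
    moreover obtain k where "k > N" "scale_dim_le M d (real k) (c * real k) n"
      using c(2) by (auto simp: infinite_nat_iff_unbounded)
    ultimately show ?thesis by (intro exI[of _ "real k"]) auto
  qed
  then show "lasdim_star_le M d n" using c(1) by (auto simp: lasdim_star_le_def)
qed

lemma lasdim_ultra_le_iff:
  assumes "\<omega> \<in> nonprincipal_ultrafilters"
  shows "lasdim_ultra M d \<omega> \<le> enat n \<longleftrightarrow>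
    (\<exists>c>0. eventually (\<lambda>k. scale_dim_le M d (real k) (c * real k) n) \<omega>)"
proof -
  have "ultra_dim M d c \<omega> \<le> enat n \<longleftrightarrow>
      eventually (\<lambda>k. scale_dim_le M d (real k) (c * real k) n) \<omega>" for c
    using assms unfolding ultra_dim_def
    by (subst Lim_ultrafilter_le_enat_iff)
      (auto simp: nonprincipal_ultrafilters_def scale_dim_def least_enat_le_iff mono_scale_dim_le)
  then show ?thesis
    by (auto simp: lasdim_ultra_def INF_le_enat_iff)
qed

theorem theorem3p2:
  fixes M :: "'a set" and d :: "'a \<Rightarrow> 'a \<Rightarrow> real"
  assumes "Metric_space M d"
  shows "lasdim_star M d = (INF \<omega>\<in>nonprincipal_ultrafilters. lasdim_ultra M d \<omega>) \<and>
         (\<exists>\<omega>\<in>nonprincipal_ultrafilters. lasdim_ultra M d \<omega> = lasdim_star M d)"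
proof -
  have eq: "lasdim_star M d = (INF \<omega>\<in>nonprincipal_ultrafilters. lasdim_ultra M d \<omega>)"
  proof (rule enat_eqI)
    fix n
    have "lasdim_star M d \<le> enat n \<longleftrightarrow>
        (\<exists>c>0. infinite {k. scale_dim_le M d (real k) (c * real k) n})"
      by (simp add: lasdim_star_def least_enat_le_iff mono_lasdim_star_le
          lasdim_star_le_iff_infinite)
    also have "\<dots> \<longleftrightarrow> (\<exists>\<omega>\<in>nonprincipal_ultrafilters. lasdim_ultra M d \<omega> \<le> enat n)"
      by (auto simp: infinite_iff_in_nonprincipal_ultrafilter lasdim_ultra_le_iff)
    also have "\<dots> \<longleftrightarrow> (INF \<omega>\<in>nonprincipal_ultrafilters. lasdim_ultra M d \<omega>) \<le> enat n"
      by (simp add: INF_le_enat_iff)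
    finally show "lasdim_star M d \<le> enat n \<longleftrightarrow>
        (INF \<omega>\<in>nonprincipal_ultrafilters. lasdim_ultra M d \<omega>) \<le> enat n" .
  qed
  have "nonprincipal_ultrafilters \<noteq> {}"
    using infinite_iff_in_nonprincipal_ultrafilter[of "\<lambda>_. True"] by auto
  then have "\<exists>\<omega>\<in>nonprincipal_ultrafilters. lasdim_ultra M d \<omega> = lasdim_star M d"
    unfolding eq using wellorder_InfI[of _ "lasdim_ultra M d ` nonprincipal_ultrafilters"] by fastforce
  with eq show ?thesis by blast
qed

end
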